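(* Let $X$ be a locally compact metrizable space on which $\mathbb Q_+^*$ acts by homeomorphisms and assume that for some $x\in X$ the closure of $\mathbb N^\times x$ is compact. Then the quotient of the product $X\times\mathbb R_+^*$ by the product action of $\mathbb Q_+^*$ is not a standard Borel space.
   Context: $\mathbb Q_+^*$ is the multiplicative group of positive rationals (discrete), $\mathbb N^\times=\{n\in\mathbb N: n>0\}\subset\mathbb Q_+^*$ the multiplicative monoid of positive integers, and $\mathbb Q_+^*$ acts on $\mathbb R_+^*=(0,\infty)$ by multiplication. The quotient (orbit space) is endowed with the quotient Borel structure. *)

theory Defs
  imports "HOL-Analysis.Analysis" "HOL-Algebra.Group_Action"
begin

definition pos_rat_group :: "rat monoid"
  where "pos_rat_group = \<lparr>carrier = {0<..}, mult = (*), one = 1\<rparr>"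

lemma comm_group_pos_rat_group: "comm_group pos_rat_group"
proof (rule comm_groupI)
  fix x assume "x \<in> carrier pos_rat_group"
  then show "\<exists>y\<in>carrier pos_rat_group. y \<otimes>\<^bsub>pos_rat_group\<^esub> x = \<one>\<^bsub>pos_rat_group\<^esub>"
    by (intro bexI[of _ "inverse x"]) (auto simp: pos_rat_group_def)
qed (auto simp: pos_rat_group_def)

definition pos_real_top :: "real topology"
  where "pos_real_top = top_of_set {0<..}"

lemma topspace_pos_real_top: "topspace pos_real_top = {0<..}"
  by (simp add: pos_real_top_def)

text \<open>The product action of the positive rationals on \<open>X \<times> (0,\<infinity>)\<close>.
  The library's group actions consist of functions that are \<^term>\<open>undefined\<close> outside the
  space acted on, whence the restriction.\<close>

definition prod_action ::
    "'a topology \<Rightarrow> (rat \<Rightarrow> 'a \<Rightarrow> 'a) \<Rightarrow> rat \<Rightarrow> 'a \<times> real \<Rightarrow> 'a \<times> real"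
  where "prod_action X \<phi> q =
    restrict (\<lambda>(x, t). (\<phi> q x, of_rat q * t)) (topspace (prod_topology X pos_real_top))"

lemma group_action_prod_action:
  assumes "group_action pos_rat_group (topspace X) \<phi>"
  shows "group_action pos_rat_group (topspace (prod_topology X pos_real_top)) (prod_action X \<phi>)"
proof -
  interpret group_action pos_rat_group "topspace X" \<phi> by (rule assms)
  let ?E = "topspace X \<times> {0<..} :: ('a \<times> real) set"
  have E: "topspace (prod_topology X pos_real_top) = ?E"
    by (simp add: topspace_pos_real_top)
  have car: "carrier pos_rat_group = {0<..}" and one: "\<one>\<^bsub>pos_rat_group\<^esub> = 1"
    and mult: "\<And>a b. a \<otimes>\<^bsub>pos_rat_group\<^esub> b = a * b"
    by (simp_all add: pos_rat_group_def)
  have cl: "\<phi> q x \<in> topspace X" if "q > 0" "x \<in> topspace X" for q x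
    using element_image[of q x] that by (auto simp: car)
  have comp: "\<phi> (p * q) x = \<phi> p (\<phi> q x)" if "p > 0" "q > 0" "x \<in> topspace X" for p q x
    using composition_rule[of x p q] that by (simp add: car mult)
  have unit: "\<phi> 1 x = x" if "x \<in> topspace X" for x
    using id_eq_one one that by (metis restrict_apply')
  have bij: "prod_action X \<phi> q \<in> Bij ?E" if q: "q > 0" for q
  proof -
    have "bij_betw (prod_action X \<phi> q) ?E ?E"
      by (rule bij_betw_byWitness[where f' = "prod_action X \<phi> (inverse q)"])
        (use q in \<open>auto simp: prod_action_def topspace_pos_real_top cl comp[symmetric] unit of_rat_inverse\<close>)
    then show ?thesis by (simp add: Bij_def prod_action_def topspace_pos_real_top)
  qed
  have "prod_action X \<phi> (p * q) = compose ?E (prod_action X \<phi> p) (prod_action X \<phi> q)"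
    if "p > 0" "q > 0" for p q
  proof
    fix z
    show "prod_action X \<phi> (p * q) z = compose ?E (prod_action X \<phi> p) (prod_action X \<phi> q) z"
      using that by (cases z)
        (simp add: compose_def prod_action_def topspace_pos_real_top restrict_def cl comp
          of_rat_mult mult.assoc)
  qed
  then have "prod_action X \<phi> \<in> hom pos_rat_group (BijGroup ?E)"
    by (simp add: hom_def BijGroup_def car mult bij Pi_iff)
  then show ?thesis
    unfolding E group_action_def group_hom_def group_hom_axioms_def
    using comm_group_pos_rat_group group_BijGroup by (auto simp: comm_group_def)
qed

definition borel_of :: "'a topology \<Rightarrow> 'a measure"
  where "borel_of X = sigma (topspace X) {U. openin X U}"

lemma space_borel_of: "space (borel_of X) = topspace X"
  unfolding borel_of_def by (rule space_measure_of) (auto dest: openin_subset)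

lemma sets_borel_of: "sets (borel_of X) = sigma_sets (topspace X) {U. openin X U}"
  unfolding borel_of_def by (rule sets_measure_of) (auto dest: openin_subset)

text \<open>The quotient Borel structure on the orbit space: a set of orbits is measurable iff
  its preimage under the orbit map is measurable. These sets already form a \<open>\<sigma>\<close>-algebra, so
  \<^const>\<open>sigma\<close> adds nothing to them (see \<open>sets_orbit_space\<close>).\<close>

definition orbit_space ::
    "('g, 'z) monoid_scheme \<Rightarrow> ('g \<Rightarrow> 'a \<Rightarrow> 'a) \<Rightarrow> 'a measure \<Rightarrow> 'a set measure"
  where "orbit_space G \<psi> M = sigma (orbits G (space M) \<psi>)
    {A. A \<subseteq> orbits G (space M) \<psi> \<and> orbit G \<psi> -` A \<inter> space M \<in> sets M}"

lemma space_orbit_space: "space (orbit_space G \<psi> M) = orbits G (space M) \<psi>"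
  unfolding orbit_space_def by (rule space_measure_of) auto

lemma sets_orbit_space:
  "sets (orbit_space G \<psi> M) =
    {A. A \<subseteq> orbits G (space M) \<psi> \<and> orbit G \<psi> -` A \<inter> space M \<in> sets M}" (is "_ = ?S")
proof -
  let ?O = "orbits G (space M) \<psi>"
  have "sigma_algebra ?O ?S"
    unfolding sigma_algebra_iff2
  proof (intro conjI ballI allI impI)
    fix A assume A: "A \<in> ?S"
    have "orbit G \<psi> -` (?O - A) \<inter> space M = space M - (orbit G \<psi> -` A \<inter> space M)"
      by (auto simp: orbits_def)
    with A show "?O - A \<in> ?S" by auto
  next
    fix A :: "nat \<Rightarrow> _" assume A: "range A \<subseteq> ?S"
    have "orbit G \<psi> -` (\<Union>i. A i) \<inter> space M = (\<Union>i. orbit G \<psi> -` A i \<inter> space M)"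
      by auto
    also have "\<dots> \<in> sets M" using A by (intro sets.countable_UN) auto
    finally show "(\<Union>i. A i) \<in> ?S" using A by auto
  qed auto
  then show ?thesis
    unfolding orbit_space_def by (simp add: sigma_algebra.sigma_sets_eq sets_measure_of[of ?S] subset_iff)
qed

text \<open>A measurable space is standard Borel if it is the Borel space of some Polish topology.
  The topology is taken on the underlying set itself; being isomorphic to the
  Borel space of a Polish space of any other type amounts to the same, by transport of structure
  (see \<open>standard_borel_isoI\<close>).\<close>

definition standard_borel :: "'a measure \<Rightarrow> bool"
  where "standard_borel M \<longleftrightarrow>
    (\<exists>T. completely_metrizable_space T \<and> second_countable T \<and>
         space M = topspace T \<and> sets M = sets (borel_of T))"

lemma standard_borel_isoI:
  fixes M :: "'a measure" and T :: "'b topology"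
  assumes T: "completely_metrizable_space T" "second_countable T"
    and f: "f \<in> M \<rightarrow>\<^sub>M borel_of T" and g: "g \<in> borel_of T \<rightarrow>\<^sub>M M"
    and gf: "\<And>x. x \<in> space M \<Longrightarrow> g (f x) = x"
    and fg: "\<And>y. y \<in> topspace T \<Longrightarrow> f (g y) = y"
  shows "standard_borel M"
proof -
  let ?P = "pullback_topology (space M) f T"
  have fs: "f x \<in> topspace T" if "x \<in> space M" for x
    using measurable_space[OF f that] by (simp add: space_borel_of)
  have gs: "g y \<in> space M" if "y \<in> topspace T" for y
    using measurable_space[OF g] that by (simp add: space_borel_of)
  have top: "topspace ?P = space M"
    using fs by (auto simp: topspace_pullback_topology)
  have cf: "continuous_map ?P T f"
    unfolding continuous_map_def
  proof (intro conjI allI impI)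
    fix U assume "openin T U"
    moreover have "{x \<in> topspace ?P. f x \<in> U} = f -` U \<inter> space M" by (auto simp: top)
    ultimately show "openin ?P {x \<in> topspace ?P. f x \<in> U}"
      by (auto simp only: openin_pullback_topology)
  qed (auto simp: top fs)
  have cg: "continuous_map T ?P g"
    unfolding continuous_map_def
  proof (intro conjI allI impI)
    fix U assume "openin ?P U"
    then obtain V where V: "openin T V" "U = f -` V \<inter> space M"
      by (auto simp: openin_pullback_topology)
    have "{y \<in> topspace T. g y \<in> U} = V"
      using V openin_subset[OF V(1)] gs fg by auto
    with V show "openin T {y \<in> topspace T. g y \<in> U}" by simp
  qed (auto simp: top gs)
  have hom: "?P homeomorphic_space T"
    unfolding homeomorphic_space_def homeomorphic_maps_def
    by (rule exI[of _ f], rule exI[of _ g]) (use cf cg in \<open>simp add: top gf fg\<close>)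
  have meas: "f -` B \<inter> space M \<in> sets M" if "B \<in> sets (borel_of T)" for B
    using measurable_sets[OF f that] .
  have "sets (borel_of ?P) = sets M"
  proof
    show "sets (borel_of ?P) \<subseteq> sets M"
      unfolding sets_borel_of top
      by (rule sets.sigma_sets_subset)
        (auto simp: openin_pullback_topology sets_borel_of intro!: meas sigma_sets.Basic)
    have fP: "f \<in> borel_of ?P \<rightarrow>\<^sub>M borel_of T"
    proof (rule measurable_sigma_sets[OF sets_borel_of])
      show "f \<in> space (borel_of ?P) \<rightarrow> topspace T" by (auto simp: space_borel_of top fs)
      show "f -` U \<inter> space (borel_of ?P) \<in> sets (borel_of ?P)" if "U \<in> {U. openin T U}" for U
        using that by (auto simp: space_borel_of top sets_borel_of openin_pullback_topology
          intro!: sigma_sets.Basic)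
    qed (auto dest: openin_subset)
    show "sets M \<subseteq> sets (borel_of ?P)"
    proof
      fix A assume A: "A \<in> sets M"
      have "f -` (g -` A \<inter> space (borel_of T)) \<inter> space (borel_of ?P) = A"
        using sets.sets_into_space[OF A] fs gf by (auto simp: space_borel_of top)
      with measurable_sets[OF fP measurable_sets[OF g A]]
      show "A \<in> sets (borel_of ?P)" by simp
    qed
  qed
  then show ?thesis
    unfolding standard_borel_def
    using T top homeomorphic_completely_metrizable_space[OF hom]
      homeomorphic_space_second_countability[OF hom]
    by (intro exI[of _ ?P]) auto
qed

end

theory Submission
  imports Defs
begin

text \<open>
  The quotient fails to be standard because some orbit in \<open>X \<times> (0,\<infinity>)\<close> accumulates at one of
  its own points, and this is incompatible with separating the orbits by countably many invariant
  Borel sets.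

  Suppose that an orbit of a countable group accumulates at itself in a locally compact Hausdorff
  space, and let \<open>Z\<close> be its closure. The orbit is dense in \<open>Z\<close>, so any two nonempty open subsets of
  \<open>Z\<close> are linked by a group element, and every invariant Borel set is meager or comeager in \<open>Z\<close>
  (\<open>topological_zero_one_law\<close>). Moreover \<open>Z\<close> has no isolated points, since a dense orbit would have to
  contain them, and then all its points would be isolated. So every orbit, being
  countable, is meager in \<open>Z\<close>. If the orbit space were standard Borel, a countable base of a
  Polish topology on it would give countably many invariant Borel sets separating the orbits;
  discarding the meager one of each such set and its complement leaves at most one orbit, so that
  \<open>Z\<close> would be meager in itself, contrary to Baire's theorem
  (\<open>not_standard_borel_orbit_space\<close>).

  To find such an orbit, start from the compact closure \<open>K\<close> of \<open>\<nat>\<^sup>\<times>x\<close>, which is mapped into itself by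
  the positive integers. The sets \<open>nK\<close> decrease along divisibility, so their intersection \<open>L\<close> is
  nonempty and compact, and it is invariant under all positive rationals
  (\<open>compact_invariant_set_of_forward_invariant\<close>). Some point \<open>y\<close> of \<open>L\<close> is brought arbitrarily near
  itself by rationals \<open>q \<noteq> 1\<close> that are arbitrarily close to \<open>1\<close> in \<open>\<real>\<close>: inside a minimal
  set, infinitely many rationals near \<open>1\<close> have to share finitely many translates of a small
  open set, and Baire's theorem makes the resulting return times simultaneous
  (\<open>recurrent_point_exists\<close>). For these \<open>q\<close> the points \<open>(qy, q)\<close> of the orbit of \<open>(y, 1)\<close> converge
  to \<open>(y, 1)\<close> and differ from it in the second coordinate.
\<close>

section \<open>Meager sets and the Baire property\<close>

definition meager_in :: "'a topology \<Rightarrow> 'a set \<Rightarrow> bool"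
  where "meager_in X S \<longleftrightarrow>
    (\<exists>\<C>. countable \<C> \<and> (\<forall>C\<in>\<C>. closedin X C \<and> X interior_of C = {}) \<and> S \<subseteq> \<Union>\<C>)"

lemma meager_in_subset: "meager_in X T \<Longrightarrow> S \<subseteq> T \<Longrightarrow> meager_in X S"
  unfolding meager_in_def by (meson order_trans)

lemma meager_in_nowhere_dense: "closedin X C \<Longrightarrow> X interior_of C = {} \<Longrightarrow> meager_in X C"
  unfolding meager_in_def by (rule exI[of _ "{C}"]) auto

lemma meager_in_empty: "meager_in X {}"
  unfolding meager_in_def by (rule exI[of _ "{}"]) auto

lemma meager_in_UN:
  assumes "countable I" "\<And>i. i \<in> I \<Longrightarrow> meager_in X (S i)"
  shows "meager_in X (\<Union>i\<in>I. S i)"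
proof -
  obtain \<C> where \<C>: "\<And>i. i \<in> I \<Longrightarrow> countable (\<C> i) \<and>
      (\<forall>C\<in>\<C> i. closedin X C \<and> X interior_of C = {}) \<and> S i \<subseteq> \<Union>(\<C> i)"
    using assms(2) unfolding meager_in_def by metis
  show ?thesis
    unfolding meager_in_def
  proof (intro exI conjI)
    show "countable (\<Union>i\<in>I. \<C> i)" using \<C> assms(1) by simp
    show "\<forall>C\<in>(\<Union>i\<in>I. \<C> i). closedin X C \<and> X interior_of C = {}" using \<C> by blast
    have "S i \<subseteq> \<Union>(\<Union>i\<in>I. \<C> i)" if "i \<in> I" for i
      using \<C>[OF that] that by (metis Sup_upper2 SUP_upper Union_mono order_trans)
    then show "(\<Union>i\<in>I. S i) \<subseteq> \<Union>(\<Union>i\<in>I. \<C> i)" by (rule UN_least)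
  qed
qed

lemma meager_in_Un:
  assumes "meager_in X S" "meager_in X T"
  shows "meager_in X (S \<union> T)"
  using meager_in_UN[of UNIV X "case_bool S T"] assms
  by (auto simp: UNIV_bool Un_commute split: bool.splits)

lemma meager_in_homeomorphic_image:
  assumes h: "homeomorphic_map X X h" and S: "meager_in X S"
  shows "meager_in X (h ` S)"
proof -
  obtain \<C> where \<C>: "countable \<C>" "\<And>C. C \<in> \<C> \<Longrightarrow> closedin X C"
      "\<And>C. C \<in> \<C> \<Longrightarrow> X interior_of C = {}" "S \<subseteq> \<Union>\<C>"
    using S unfolding meager_in_def by blast
  have "closedin X (h ` C) \<and> X interior_of (h ` C) = {}" if "C \<in> \<C>" for C
    using \<C>(2,3)[OF that] homeomorphic_map_closedness_eq[OF h, of C] closedin_subset[of X C]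
      homeomorphic_map_interior_of[OF h, of C] by auto
  then show ?thesis
    unfolding meager_in_def
  proof (intro exI[of _ "image h ` \<C>"] conjI)
    have "h ` S \<subseteq> h ` \<Union>\<C>" using \<C>(4) by (rule image_mono)
    then show "h ` S \<subseteq> \<Union>(image h ` \<C>)" by (simp add: image_Union)
  qed (use \<C>(1) in auto)
qed

text \<open>Baire's theorem in the form that yields contradictions: a set and its complement cannot both
  be comeager in the same nonempty open set.\<close>

lemma open_meager_in_empty:
  assumes "locally_compact_space X" "regular_space X" "openin X U" "meager_in X U"
  shows "U = {}"
proof -
  obtain \<C> where \<C>: "countable \<C>" "\<And>C. C \<in> \<C> \<Longrightarrow> closedin X C \<and> X interior_of C = {}"
      "U \<subseteq> \<Union>\<C>"
    using assms(4) unfolding meager_in_def by blast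
  have "X interior_of \<Union>\<C> = {}"
    using assms(1,2) \<C> by (intro Baire_category_alt) auto
  then show ?thesis
    using \<C>(3) assms(3) unfolding interior_of_eq_empty by blast
qed

definition baire_property :: "'a topology \<Rightarrow> 'a set \<Rightarrow> bool"
  where "baire_property X A \<longleftrightarrow> (\<exists>U. openin X U \<and> meager_in X (A - U) \<and> meager_in X (U - A))"

lemma baire_property_open: "openin X U \<Longrightarrow> baire_property X U"
  unfolding baire_property_def by (rule exI[of _ U]) (auto simp: meager_in_empty)

text \<open>The complement of an open set is open up to its frontier, which is nowhere dense; so it may be
  replaced by the complement of the closure.\<close>

lemma baire_property_complement:
  assumes "baire_property X A"
  shows "baire_property X (topspace X - A)"
proof -
  obtain U where U: "openin X U" "meager_in X (A - U)" "meager_in X (U - A)"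
    using assms unfolding baire_property_def by blast
  have "meager_in X (X frontier_of U)"
  proof (intro meager_in_nowhere_dense closedin_frontier_of)
    have "W = {}" if "openin X W" "W \<subseteq> X frontier_of U" for W
      using openin_Int_closure_of_eq_empty[OF that(1), of U] that(2) U(1)
      by (auto simp: frontier_of_def interior_of_openin)
    then show "X interior_of (X frontier_of U) = {}"
      by (simp add: interior_of_eq_empty)
  qed
  then have m: "meager_in X (X frontier_of U \<union> (U - A))"
    using U(3) by (rule meager_in_Un)
  show ?thesis
    unfolding baire_property_def
  proof (intro exI conjI)
    show "openin X (topspace X - X closure_of U)" by auto
    show "meager_in X ((topspace X - A) - (topspace X - X closure_of U))"
      using m by (rule meager_in_subset) (use U(1) in \<open>auto simp: frontier_of_def interior_of_openin\<close>)
    show "meager_in X ((topspace X - X closure_of U) - (topspace X - A))"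
      using U(2) by (rule meager_in_subset)
        (use closure_of_subset[OF openin_subset[OF U(1)]] in auto)
  qed
qed

lemma baire_property_UN:
  assumes "\<And>i::nat. baire_property X (A i)"
  shows "baire_property X (\<Union>i. A i)"
proof -
  obtain U where U: "\<And>i. openin X (U i)" "\<And>i. meager_in X (A i - U i)" "\<And>i. meager_in X (U i - A i)"
    using assms unfolding baire_property_def by metis
  show ?thesis
    unfolding baire_property_def
  proof (intro exI conjI)
    show "openin X (\<Union>i. U i)" using U(1) by auto
    show "meager_in X ((\<Union>i. A i) - (\<Union>i. U i))"
      using meager_in_UN[of UNIV, OF _ U(2)] by (rule meager_in_subset) auto
    show "meager_in X ((\<Union>i. U i) - (\<Union>i. A i))"
      using meager_in_UN[of UNIV, OF _ U(3)] by (rule meager_in_subset) auto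
  qed
qed

text \<open>Category will be measured inside an orbit closure \<open>Z\<close>, which may itself be meager in \<open>X\<close>;
  hence the trace on a subspace.\<close>

lemma borel_Int_baire_property:
  assumes "A \<in> sets (borel_of X)" "Z \<subseteq> topspace X"
  shows "baire_property (subtopology X Z) (A \<inter> Z)"
  using assms(1) unfolding sets_borel_of
proof (induction rule: sigma_sets.induct)
  case (Basic U)
  then show ?case by (auto intro!: baire_property_open simp: openin_subtopology)
next
  case Empty
  then show ?case by (auto intro!: baire_property_open)
next
  case (Compl A)
  have "(topspace X - A) \<inter> Z = topspace (subtopology X Z) - A \<inter> Z"
    using assms(2) by auto
  then show ?case using baire_property_complement[OF Compl.IH] by simp
next
  case (Union A)
  have "\<Union>(range A) \<inter> Z = (\<Union>i. A i \<inter> Z)" by auto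
  then show ?case using baire_property_UN[OF Union.IH] by simp
qed

text \<open>If neither \<open>A\<close> nor its complement is meager, each of them agrees up to a meager set with a
  nonempty open set, \<open>U\<close> and \<open>V\<close> say. A homeomorphism \<open>h\<close> that preserves \<open>A\<close> and links \<open>U\<close> to \<open>V\<close>
  makes \<open>A\<close> and its complement both comeager in the nonempty open set \<open>h ` U \<inter> V\<close>, which is
  impossible by Baire's theorem.\<close>

lemma topological_zero_one_law:
  assumes X: "locally_compact_space X" "regular_space X"
    and A: "baire_property X A"
    and trans: "\<And>U V. openin X U \<Longrightarrow> openin X V \<Longrightarrow> U \<noteq> {} \<Longrightarrow> V \<noteq> {} \<Longrightarrow>
      \<exists>h. homeomorphic_map X X h \<and> h ` A \<subseteq> A \<and> h ` U \<inter> V \<noteq> {}"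
  shows "meager_in X A \<or> meager_in X (topspace X - A)"
proof -
  obtain U where U: "openin X U" "meager_in X (A - U)" "meager_in X (U - A)"
    using A unfolding baire_property_def by blast
  obtain V where V: "openin X V" "meager_in X ((topspace X - A) - V)"
      "meager_in X (V - (topspace X - A))"
    using baire_property_complement[OF A] unfolding baire_property_def by blast
  have False if ne: "U \<noteq> {}" "V \<noteq> {}"
  proof -
    obtain h where h: "homeomorphic_map X X h" "h ` A \<subseteq> A" "h ` U \<inter> V \<noteq> {}"
      using trans[OF U(1) V(1) ne] by metis
    have "openin X (h ` U \<inter> V)"
      using U(1) V(1) homeomorphic_map_openness_eq[OF h(1)] by blast
    moreover have "meager_in X (h ` U \<inter> V)"
      using meager_in_Un[OF meager_in_homeomorphic_image[OF h(1) U(3)] V(3)]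
      by (rule meager_in_subset) (use h(2) in auto)
    ultimately show False
      using open_meager_in_empty[OF X] h(3) by blast
  qed
  then have "U = {} \<or> V = {}" by blast
  then show ?thesis
    using U(2) V(2) meager_in_subset[of X "topspace X - A - V" "topspace X - A"] by auto
qed

section \<open>Orbits that accumulate at themselves\<close>

locale continuous_action = group_action G "topspace X" \<phi>
  for G (structure) and X :: "'a topology" and \<phi> +
  assumes continuous: "g \<in> carrier G \<Longrightarrow> continuous_map X X (\<phi> g)"
begin

sublocale group G
  using group_hom group_hom.axioms(1) by auto

lemma act_in: "g \<in> carrier G \<Longrightarrow> y \<in> topspace X \<Longrightarrow> \<phi> g y \<in> topspace X"
  using element_image by blast

lemma act_act: "g \<in> carrier G \<Longrightarrow> h \<in> carrier G \<Longrightarrow> y \<in> topspace X \<Longrightarrow> \<phi> g (\<phi> h y) = \<phi> (g \<otimes> h) y"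
  using composition_rule by simp

lemma act_one: "y \<in> topspace X \<Longrightarrow> \<phi> \<one> y = y"
  using id_eq_one by (metis restrict_apply')

lemma act_inv: "g \<in> carrier G \<Longrightarrow> y \<in> topspace X \<Longrightarrow> \<phi> (inv g) (\<phi> g y) = y"
  by (simp add: act_act act_one)

lemma act_inv': "g \<in> carrier G \<Longrightarrow> y \<in> topspace X \<Longrightarrow> \<phi> g (\<phi> (inv g) y) = y"
  by (simp add: act_act act_one)

lemma orbit_act_eq:
  assumes "g \<in> carrier G" "y \<in> topspace X"
  shows "orbit G \<phi> (\<phi> g y) = orbit G \<phi> y"
proof
  show "orbit G \<phi> (\<phi> g y) \<subseteq> orbit G \<phi> y"
    using assms by (auto simp: orbit_def act_act)
  show "orbit G \<phi> y \<subseteq> orbit G \<phi> (\<phi> g y)"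
  proof
    fix w assume "w \<in> orbit G \<phi> y"
    then obtain k where k: "k \<in> carrier G" "w = \<phi> k y" by (auto simp: orbit_def)
    then have "w = \<phi> (k \<otimes> inv g) (\<phi> g y)"
      using assms by (simp add: act_act m_assoc)
    then show "w \<in> orbit G \<phi> (\<phi> g y)"
      using k(1) assms(1) unfolding orbit_def by blast
  qed
qed

lemma openin_act_image:
  assumes "g \<in> carrier G" "openin X U"
  shows "openin X (\<phi> g ` U)"
proof -
  have "\<phi> g ` U = {y \<in> topspace X. \<phi> (inv g) y \<in> U}" (is "_ = ?R")
  proof
    show "\<phi> g ` U \<subseteq> ?R"
      using openin_subset[OF assms(2)] assms(1) by (auto simp: act_in act_inv subset_iff)
    show "?R \<subseteq> \<phi> g ` U"
    proof
      fix w assume "w \<in> ?R"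
      then show "w \<in> \<phi> g ` U"
        using act_inv'[OF assms(1), of w] by (intro image_eqI[of _ _ "\<phi> (inv g) w"]) auto
    qed
  qed
  then show ?thesis
    using assms continuous[of "inv g"] openin_continuous_map_preimage by fastforce
qed

lemma act_closure_subset:
  assumes "g \<in> carrier G" "\<phi> g ` S \<subseteq> S"
  shows "\<phi> g ` (X closure_of S) \<subseteq> X closure_of S"
  using continuous_map_image_closure_subset[OF continuous[OF assms(1)], of S]
    closure_of_mono[OF assms(2), of X] by blast

lemma homeomorphic_map_invariant_subspace:
  assumes "Z \<subseteq> topspace X" "\<And>g. g \<in> carrier G \<Longrightarrow> \<phi> g ` Z \<subseteq> Z" "g \<in> carrier G"
  shows "homeomorphic_map (subtopology X Z) (subtopology X Z) (\<phi> g)"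
proof -
  have c: "continuous_map (subtopology X Z) (subtopology X Z) (\<phi> h)" if "h \<in> carrier G" for h
    using continuous_map_from_subtopology[OF continuous[OF that]] assms(2)[OF that]
    by (auto simp: continuous_map_in_subtopology)
  have "homeomorphic_maps (subtopology X Z) (subtopology X Z) (\<phi> g) (\<phi> (inv g))"
    unfolding homeomorphic_maps_def using assms c by (auto simp: act_inv act_inv')
  then show ?thesis by (simp add: homeomorphic_maps_map)
qed

text \<open>The easy half of the Glimm--Effros dichotomy. The argument takes place in the closure \<open>Z\<close>
  of the orbit, where the 0-1 law applies to invariant Borel sets and all orbits are meager.\<close>

theorem not_standard_borel_orbit_space:
  assumes lc: "locally_compact_space X" and haus: "Hausdorff_space X"
    and G: "countable (carrier G)"
    and z: "z \<in> X derived_set_of (orbit G \<phi> z)"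
  shows "\<not> standard_borel (orbit_space G \<phi> (borel_of X))"
proof
  assume "standard_borel (orbit_space G \<phi> (borel_of X))"
  then obtain T where T: "completely_metrizable_space T" "second_countable T"
      "orbits G (topspace X) \<phi> = topspace T" "sets (orbit_space G \<phi> (borel_of X)) = sets (borel_of T)"
    unfolding standard_borel_def space_orbit_space space_borel_of by blast
  have zX: "z \<in> topspace X" using z by (simp add: in_derived_set_of)
  define Z where "Z = X closure_of (orbit G \<phi> z)"
  define S where "S = subtopology X Z"
  have ZX: "Z \<subseteq> topspace X" by (simp add: Z_def closure_of_subset_topspace)
  have Oz: "orbit G \<phi> z \<subseteq> Z"
    unfolding Z_def by (rule closure_of_subset) (auto simp: orbit_def act_in zX)
  have topS: "topspace S = Z" using ZX by (auto simp: S_def)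
  have zZ: "z \<in> Z" using Oz orbit_refl[OF zX] by blast
  have inv: "\<phi> g ` Z \<subseteq> Z" if "g \<in> carrier G" for g
    unfolding Z_def using that
    by (rule act_closure_subset) (use that zX in \<open>auto simp: orbit_def act_act\<close>)
  have homS: "homeomorphic_map S S (\<phi> g)" if "g \<in> carrier G" for g
    unfolding S_def using ZX inv that by (rule homeomorphic_map_invariant_subspace)
  have reg: "regular_space S"
    unfolding S_def using lc haus
    by (intro regular_space_subtopology locally_compact_Hausdorff_imp_regular_space)
  have lcS: "locally_compact_space S"
    unfolding S_def using lc by (rule locally_compact_space_closed_subset) (simp add: Z_def)
  have dense: "\<exists>g\<in>carrier G. \<phi> g z \<in> U" if "openin S U" "U \<noteq> {}" for U
  proof -
    obtain V where V: "openin X V" "U = V \<inter> Z"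
      using \<open>openin S U\<close> by (auto simp: S_def openin_subtopology)
    then obtain w where "w \<in> V" "w \<in> X closure_of (orbit G \<phi> z)"
      using \<open>U \<noteq> {}\<close> by (auto simp: Z_def)
    then obtain y where "y \<in> orbit G \<phi> z" "y \<in> V"
      using V(1) by (auto simp: in_closure_of)
    then show ?thesis using Oz V(2) by (auto simp: orbit_def)
  qed
  have orbit_meager: "meager_in S (orbit G \<phi> y \<inter> Z)" if y: "y \<in> topspace X" for y
  proof -
    have "meager_in S {w}" if w: "w \<in> Z" for w
    proof (rule meager_in_nowhere_dense)
      have "Hausdorff_space S" unfolding S_def using haus by (rule Hausdorff_space_subtopology)
      then show "closedin S {w}"
        using w by (intro closedin_Hausdorff_sing_eq[THEN iffD2]) (auto simp: topS)
      show "S interior_of {w} = {}"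
      proof (rule ccontr)
        assume "S interior_of {w} \<noteq> {}"
        then have ow: "openin S {w}"
          by (metis interior_of_subset openin_interior_of subset_singletonD)
        then obtain g where g: "g \<in> carrier G" "\<phi> g z = w"
          using dense[of "{w}"] by auto
        \<comment> \<open>Translating the isolated point back along the orbit would make \<open>z\<close> isolated in \<open>Z\<close>.\<close>
        have "openin S (\<phi> (inv g) ` {w})"
          using homS[of "inv g"] g(1) ow homeomorphic_map_openness_eq by blast
        then have "openin S {z}" using g act_inv[OF g(1) zX] by simp
        then obtain V where V: "openin X V" "{z} = V \<inter> Z"
          by (auto simp: S_def openin_subtopology)
        then obtain y where "y \<noteq> z" "y \<in> orbit G \<phi> z" "y \<in> V"
          using z by (auto simp: in_derived_set_of)
        then show False using V(2) Oz by blast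
      qed
    qed
    then have "meager_in S (\<Union>w\<in>orbit G \<phi> y \<inter> Z. {w})"
      by (intro meager_in_UN)
        (auto simp: orbit_def Setcompr_eq_image intro!: countable_Int1 countable_image G)
    then show ?thesis by simp
  qed
  obtain \<B> where \<B>: "countable \<B>" "\<And>B. B \<in> \<B> \<Longrightarrow> openin T B"
      "\<And>U y. openin T U \<Longrightarrow> y \<in> U \<Longrightarrow> \<exists>B\<in>\<B>. y \<in> B \<and> B \<subseteq> U"
    using T(2) unfolding second_countable_def by metis
  define A where "A B = orbit G \<phi> -` B \<inter> Z" for B
  have zero_one: "meager_in S (A B) \<or> meager_in S (Z - A B)" if "B \<in> \<B>" for B
  proof -
    have "B \<in> sets (orbit_space G \<phi> (borel_of X))"
      unfolding T(4) sets_borel_of using \<B>(2)[OF that] by auto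
    then have "orbit G \<phi> -` B \<inter> topspace X \<in> sets (borel_of X)"
      by (simp add: sets_orbit_space space_borel_of)
    moreover have "orbit G \<phi> -` B \<inter> topspace X \<inter> Z = A B"
      using ZX by (auto simp: A_def)
    ultimately have bp: "baire_property S (A B)"
      using borel_Int_baire_property[of _ X Z] ZX by (fastforce simp: S_def)
    have "meager_in S (A B) \<or> meager_in S (topspace S - A B)"
      using lcS reg bp
    proof (rule topological_zero_one_law)
      fix U V assume UV: "openin S U" "openin S V" "U \<noteq> {}" "V \<noteq> {}"
      obtain g h where gh: "g \<in> carrier G" "\<phi> g z \<in> U" "h \<in> carrier G" "\<phi> h z \<in> V"
        using dense UV by meson
      define k where "k = h \<otimes> inv g"
      have k: "k \<in> carrier G" using gh by (simp add: k_def)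
      have "\<phi> k (\<phi> g z) = \<phi> h z"
        using gh zX by (simp add: k_def act_act m_assoc)
      then have "\<phi> k ` U \<inter> V \<noteq> {}" using gh by (metis IntI emptyE imageI)
      moreover have "\<phi> k ` A B \<subseteq> A B"
      proof
        fix w assume "w \<in> \<phi> k ` A B"
        then obtain y where y: "y \<in> Z" "orbit G \<phi> y \<in> B" "w = \<phi> k y" by (auto simp: A_def)
        then show "w \<in> A B" using inv[OF k] ZX orbit_act_eq[OF k, of y] by (auto simp: A_def)
      qed
      ultimately show "\<exists>h. homeomorphic_map S S h \<and> h ` A B \<subseteq> A B \<and> h ` U \<inter> V \<noteq> {}"
        using homS[OF k] by blast
    qed
    then show ?thesis by (simp add: topS)
  qed
  \<comment> \<open>A point of \<open>Z\<close> outside all the meager sets \<open>N B\<close> lies in \<open>A B\<close> exactly when \<open>A B\<close> is not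
    meager, whatever the point; so any two such points have the same orbit.\<close>
  define N where "N B = (if meager_in S (A B) then A B else Z - A B)" for B
  have N: "meager_in S (\<Union>B\<in>\<B>. N B)"
    using \<B>(1) zero_one by (intro meager_in_UN) (auto simp: N_def)
  have notall: "\<not> meager_in S Z"
    using open_meager_in_empty[OF lcS reg, of Z] zZ openin_topspace[of S] by (auto simp: topS)
  have "\<not> Z \<subseteq> (\<Union>B\<in>\<B>. N B)"
    using N notall meager_in_subset by blast
  then obtain c where c: "c \<in> Z" "\<And>B. B \<in> \<B> \<Longrightarrow> c \<notin> N B" by blast
  have same: "orbit G \<phi> y = orbit G \<phi> c" if y: "y \<in> Z" "\<And>B. B \<in> \<B> \<Longrightarrow> y \<notin> N B" for y
  proof (rule ccontr)
    assume ne: "orbit G \<phi> y \<noteq> orbit G \<phi> c"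
    have in_T: "orbit G \<phi> y \<in> topspace T" "orbit G \<phi> c \<in> topspace T"
      unfolding T(3)[symmetric] orbits_def using y(1) c(1) ZX by auto
    have "Hausdorff_space T"
      using T(1) by (intro metrizable_imp_Hausdorff_space completely_metrizable_imp_metrizable_space)
    then obtain U where U: "openin T U" "orbit G \<phi> y \<in> U" "orbit G \<phi> c \<notin> U"
      using in_T ne unfolding Hausdorff_space_def disjnt_iff by metis
    then obtain B where "B \<in> \<B>" "orbit G \<phi> y \<in> B" "orbit G \<phi> c \<notin> B"
      using \<B>(3)[OF U(1,2)] by blast
    then show False
      using c(1) c(2)[of B] y(1) y(2)[of B] by (auto simp: N_def A_def split: if_splits)
  qed
  have "Z \<subseteq> (orbit G \<phi> c \<inter> Z) \<union> (\<Union>B\<in>\<B>. N B)"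
    using same orbit_refl ZX by blast
  then have "meager_in S Z"
    using meager_in_subset[OF meager_in_Un[OF orbit_meager N]] c(1) ZX by blast
  with notall show False ..
qed

end

section \<open>Recurrence in compact invariant sets\<close>

context continuous_action
begin

text \<open>The complement in \<open>L\<close> of a maximal open invariant set that does not cover \<open>L\<close> is a minimal
  invariant set. Zorn's lemma applies because, by compactness, a chain whose union covers \<open>L\<close> has a
  member that already covers it. The last conclusion is the form in which minimality is used: the
  translates of an open set \<open>V\<close> that meets \<open>M\<close> make up, together with the maximal set, a larger open
  invariant set, so they cover \<open>M\<close>, and finitely many of them suffice.\<close>

lemma minimal_invariant_set:
  assumes L: "compactin X L" "L \<noteq> {}"
    and Linv: "\<And>g. g \<in> carrier G \<Longrightarrow> \<phi> g ` L \<subseteq> L"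
  obtains M where "M \<subseteq> L" "M \<noteq> {}" "closedin (subtopology X L) M"
    "\<And>g. g \<in> carrier G \<Longrightarrow> \<phi> g ` M \<subseteq> M"
    "\<And>V. openin X V \<Longrightarrow> V \<inter> M \<noteq> {} \<Longrightarrow>
      \<exists>F. finite F \<and> F \<subseteq> carrier G \<and> M \<subseteq> (\<Union>g\<in>F. \<phi> g ` V)"
proof -
  have LX: "L \<subseteq> topspace X" using L(1) by (rule compactin_subset_topspace)
  define \<U> where "\<U> = {U. openin X U \<and> (\<forall>g\<in>carrier G. \<phi> g ` U \<subseteq> U) \<and> \<not> L \<subseteq> U}"
  have "\<exists>U\<in>\<U>. \<forall>W\<in>\<U>. U \<subseteq> W \<longrightarrow> W = U"
  proof (rule subset_Zorn_nonempty)
    have "{} \<in> \<U>" using L(2) by (auto simp: \<U>_def)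
    then show "\<U> \<noteq> {}" by blast
    fix \<C> assume ne: "\<C> \<noteq> {}" and ch: "subset.chain \<U> \<C>"
    have sub: "\<C> \<subseteq> \<U>" using ch by (simp add: subset_chain_def)
    have "\<not> L \<subseteq> \<Union>\<C>"
    proof
      assume "L \<subseteq> \<Union>\<C>"
      then obtain \<F> where \<F>: "finite \<F>" "\<F> \<subseteq> \<C>" "L \<subseteq> \<Union>\<F>"
        using L(1) sub unfolding compactin_def \<U>_def by blast
      have "\<F> \<noteq> {}" using \<F>(3) L(2) by auto
      moreover have "subset.chain \<U> \<F>"
        using ch \<F>(2) unfolding subset_chain_def by (meson order_trans subsetD)
      ultimately have "\<Union>\<F> \<in> \<F>" using \<F>(1) by (intro Union_in_chain)
      then show False using \<F>(2,3) sub unfolding \<U>_def by blast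
    qed
    then show "\<Union>\<C> \<in> \<U>" using sub unfolding \<U>_def by fast
  qed
  then obtain U where "U \<in> \<U>" and Umax: "\<And>W. W \<in> \<U> \<Longrightarrow> U \<subseteq> W \<Longrightarrow> W = U"
    by metis
  then have U: "openin X U" "\<And>g. g \<in> carrier G \<Longrightarrow> \<phi> g ` U \<subseteq> U" "\<not> L \<subseteq> U"
    by (auto simp: \<U>_def)
  show thesis
  proof
    show "L - U \<subseteq> L" "L - U \<noteq> {}" using U(3) by auto
    show "closedin (subtopology X L) (L - U)"
      unfolding closedin_subtopology using U(1) LX
      by (intro exI[of _ "topspace X - U"]) auto
    show "\<phi> g ` (L - U) \<subseteq> L - U" if g: "g \<in> carrier G" for g
    proof
      fix w assume "w \<in> \<phi> g ` (L - U)"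
      then obtain y where y: "y \<in> L" "y \<notin> U" "w = \<phi> g y" by auto
      have "w \<notin> U"
        using U(2)[of "inv g"] g act_inv[OF g, of y] y LX by (metis image_subset_iff inv_closed subsetD)
      then show "w \<in> L - U" using Linv[OF g] y by auto
    qed
    fix V assume V: "openin X V" "V \<inter> (L - U) \<noteq> {}"
    define W where "W = U \<union> (\<Union>g\<in>carrier G. \<phi> g ` V)"
    have VX: "V \<subseteq> topspace X" using V(1) by (rule openin_subset)
    have "V \<subseteq> W"
    proof
      fix v assume v: "v \<in> V"
      then have "v \<in> \<phi> \<one> ` V" using VX by (intro image_eqI[of _ _ v]) (auto simp: act_one)
      then show "v \<in> W" unfolding W_def by blast
    qed
    have "openin X W"
      unfolding W_def using U(1) V(1) openin_act_image by auto
    moreover have "\<phi> g ` W \<subseteq> W" if g: "g \<in> carrier G" for g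
    proof -
      have "\<phi> g (\<phi> k v) \<in> W" if kv: "k \<in> carrier G" "v \<in> V" for k v
      proof -
        have "\<phi> g (\<phi> k v) = \<phi> (g \<otimes> k) v" using g kv VX by (simp add: act_act subset_iff)
        then show ?thesis using g kv unfolding W_def by (metis UN_I UnI2 imageI m_closed)
      qed
      moreover have "\<phi> g u \<in> W" if "u \<in> U" for u
        using U(2)[OF g] that by (auto simp: W_def)
      moreover have "u \<in> U \<or> (\<exists>k\<in>carrier G. \<exists>v\<in>V. u = \<phi> k v)" if "u \<in> W" for u
        using that by (auto simp: W_def)
      ultimately show ?thesis by (metis image_subsetI)
    qed
    moreover have "W \<noteq> U" using V(2) \<open>V \<subseteq> W\<close> by blast
    moreover have "U \<subseteq> W" by (simp add: W_def)
    ultimately have "L \<subseteq> W" using Umax[of W] unfolding \<U>_def by blast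
    then have "L \<subseteq> \<Union>(insert U ((\<lambda>g. \<phi> g ` V) ` carrier G))" by (auto simp: W_def)
    moreover have "openin X Q" if "Q \<in> insert U ((\<lambda>g. \<phi> g ` V) ` carrier G)" for Q
      using that U(1) V(1) openin_act_image by auto
    ultimately obtain \<F> where \<F>: "finite \<F>" "\<F> \<subseteq> insert U ((\<lambda>g. \<phi> g ` V) ` carrier G)" "L \<subseteq> \<Union>\<F>"
      using L(1) unfolding compactin_def by meson
    have "finite (\<F> - {U})" "\<F> - {U} \<subseteq> (\<lambda>g. \<phi> g ` V) ` carrier G"
      using \<F>(1,2) by auto
    then obtain F where "F \<subseteq> carrier G" "finite F" "\<F> - {U} = (\<lambda>g. \<phi> g ` V) ` F"
      using finite_subset_image by metis
    then have "\<F> \<subseteq> insert U ((\<lambda>g. \<phi> g ` V) ` F)" by blast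
    then have "\<Union>\<F> \<subseteq> \<Union>(insert U ((\<lambda>g. \<phi> g ` V) ` F))" by (rule Union_mono)
    with \<F>(3) have "L \<subseteq> \<Union>(insert U ((\<lambda>g. \<phi> g ` V) ` F))" by (rule order_trans)
    then have "L - U \<subseteq> (\<Union>g\<in>F. \<phi> g ` V)" by auto
    with \<open>F \<subseteq> carrier G\<close> \<open>finite F\<close>
    show "\<exists>F. finite F \<and> F \<subseteq> carrier G \<and> L - U \<subseteq> (\<Union>g\<in>F. \<phi> g ` V)" by blast
  qed
qed

text \<open>Simultaneous recurrence along a sequence of infinite sets \<open>E n\<close> of group elements: one point \<open>y\<close> is
  returned near itself by quotients of distinct elements of each \<open>E n\<close>. In a minimal set \<open>M\<close>,
  the points moved by less than \<open>1 / Suc m\<close> by such a quotient form an open set \<open>D (n, m)\<close>, and it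
  is dense: finitely many translates of a small open set \<open>B\<close> cover \<open>M\<close>, so for any \<open>w\<close> in \<open>M\<close> two of
  the infinitely many elements of \<open>E n\<close> send \<open>w\<close> into the same translate \<open>gB\<close>, and multiplication
  by \<open>g\<inverse>\<close> gives two points of \<open>B\<close> that differ by the quotient of the two elements. This last step
  uses commutativity. By Baire's theorem, the sets \<open>D (n, m)\<close> have a common point.\<close>

lemma recurrent_point_exists:
  assumes comm: "comm_group G" and X: "metrizable_space X"
    and L: "compactin X L" "L \<noteq> {}" "\<And>g. g \<in> carrier G \<Longrightarrow> \<phi> g ` L \<subseteq> L"
    and E: "\<And>n::nat. infinite (E n)" "\<And>n. E n \<subseteq> carrier G"
  obtains y where "y \<in> L"
    "\<And>n U. openin X U \<Longrightarrow> y \<in> U \<Longrightarrow> \<exists>a\<in>E n. \<exists>b\<in>E n. a \<noteq> b \<and> \<phi> (a \<otimes> inv b) y \<in> U"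
proof -
  interpret comm_group G by (rule comm)
  obtain M where M: "M \<subseteq> L" "M \<noteq> {}" "closedin (subtopology X L) M"
      "\<And>g. g \<in> carrier G \<Longrightarrow> \<phi> g ` M \<subseteq> M"
      and cover: "\<And>V. openin X V \<Longrightarrow> V \<inter> M \<noteq> {} \<Longrightarrow>
        \<exists>F. finite F \<and> F \<subseteq> carrier G \<and> M \<subseteq> (\<Union>g\<in>F. \<phi> g ` V)"
    using minimal_invariant_set[OF L] by metis
  have MX: "M \<subseteq> topspace X" using M(1) compactin_subset_topspace[OF L(1)] by blast
  have "closedin X L"
    using X L(1) by (intro compactin_imp_closedin metrizable_imp_Hausdorff_space)
  then have "closedin X M" using M(3) closedin_trans_full by blast
  then have cM: "compactin X M" using closed_compactin[OF L(1) M(1)] by blast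
  define S where "S = subtopology X M"
  have topS: "topspace S = M" using MX by (auto simp: S_def)
  have lc: "locally_compact_space S"
    unfolding S_def using cM by (intro compact_imp_locally_compact_space compact_space_subtopology)
  have reg: "regular_space S"
    unfolding S_def using X by (intro regular_space_subtopology metrizable_imp_regular_space)
  obtain K d where "Metric_space K d" and Xd: "X = Metric_space.mtopology K d"
    using X unfolding metrizable_space_def by blast
  interpret Metric_space K d by fact
  have KX: "topspace X = K" by (simp add: Xd)
  define Q where "Q n = {a \<otimes> inv b | a b. a \<in> E n \<and> b \<in> E n \<and> a \<noteq> b}" for n
  have Qc: "q \<in> carrier G" if "q \<in> Q n" for q n using that E(2)[of n] by (auto simp: Q_def)
  define D where "D = (\<lambda>(n, m::nat). {u \<in> M. \<exists>q\<in>Q n. d u (\<phi> q u) < 1 / Suc m})"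
  have openD: "openin S (D i)" for i
  proof -
    obtain n m where i: "i = (n, m)" by (cases i)
    have "openin X {u \<in> topspace X. d u (\<phi> q u) < 1 / Suc m}" if "q \<in> Q n" for q
    proof -
      have "continuous_map X euclidean (\<lambda>u. mdist (metric (K, d)) u (\<phi> q u))"
        using continuous[OF Qc[OF that]] Metric_space_axioms
        by (intro continuous_map_mdist) (auto simp: mtopology_of_def Xd[symmetric])
      then have "continuous_map X euclidean (\<lambda>u. d u (\<phi> q u))"
        using Metric_space_axioms by simp
      from openin_continuous_map_preimage[OF this, of "{..< 1 / Suc m}"]
      show ?thesis by simp
    qed
    then have "openin X (\<Union>q\<in>Q n. {u \<in> topspace X. d u (\<phi> q u) < 1 / Suc m})" by blast
    moreover have "D i = (\<Union>q\<in>Q n. {u \<in> topspace X. d u (\<phi> q u) < 1 / Suc m}) \<inter> M"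
      using MX by (auto simp: D_def i)
    ultimately show ?thesis unfolding S_def openin_subtopology by blast
  qed
  have denseD: "S closure_of (D i) = topspace S" for i
  proof -
    obtain n m where i: "i = (n, m)" by (cases i)
    have "U \<inter> D i \<noteq> {}" if U: "openin S U" "U \<noteq> {}" for U
    proof -
      obtain V where V: "openin X V" "U = V \<inter> M"
        using U(1) by (auto simp: S_def openin_subtopology)
      obtain w where w: "w \<in> V" "w \<in> M" using V U(2) by auto
      define B where "B = V \<inter> mball w (1 / (2 * Suc m))"
      have wK: "w \<in> K" using w MX KX by auto
      have "openin X B" using V(1) by (auto simp: B_def Xd)
      moreover have "w \<in> B" using w wK by (simp add: B_def)
      ultimately obtain F where F: "finite F" "F \<subseteq> carrier G" "M \<subseteq> (\<Union>g\<in>F. \<phi> g ` B)"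
        using cover[of B] w by blast
      have "\<exists>g\<in>F. \<phi> a w \<in> \<phi> g ` B" if "a \<in> E n" for a
        using F(3) M(4)[of a] w(2) E(2)[of n] that by blast
      then obtain f where f: "\<And>a. a \<in> E n \<Longrightarrow> f a \<in> F" "\<And>a. a \<in> E n \<Longrightarrow> \<phi> a w \<in> \<phi> (f a) ` B"
        by metis
      have "\<not> inj_on f (E n)"
        using E(1)[of n] F(1) f(1) finite_subset finite_imageD by (metis image_subsetI)
      then obtain a b where ab: "a \<in> E n" "b \<in> E n" "a \<noteq> b" "f a = f b"
        by (auto simp: inj_on_def)
      define g where "g = f a"
      have g: "g \<in> carrier G" using f(1)[OF ab(1)] F(2) by (auto simp: g_def)
      have abG: "a \<in> carrier G" "b \<in> carrier G" using ab E(2) by auto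
      have wX: "w \<in> topspace X" using w MX by auto
      define u where "u = \<phi> (inv g \<otimes> b) w"
      define v where "v = \<phi> (inv g \<otimes> a) w"
      have BX: "B \<subseteq> topspace X" using \<open>openin X B\<close> by (rule openin_subset)
      have pull: "\<phi> (inv g \<otimes> c) w \<in> B" if c: "c \<in> carrier G" "\<phi> c w \<in> \<phi> g ` B" for c
      proof -
        obtain e where e: "e \<in> B" "\<phi> c w = \<phi> g e" using c(2) by blast
        then have "\<phi> (inv g) (\<phi> c w) = e" using g BX act_inv by auto
        then show ?thesis using e(1) g c(1) wX by (simp add: act_act)
      qed
      have uB: "u \<in> B" unfolding u_def using pull abG(2) f(2)[OF ab(2)] ab(4) by (simp add: g_def)
      have vB: "v \<in> B" unfolding v_def using pull abG(1) f(2)[OF ab(1)] by (simp add: g_def)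
      have "(a \<otimes> inv b) \<otimes> (inv g \<otimes> b) = inv g \<otimes> a"
        using abG g by (simp add: m_ac) (metis inv_closed l_cancel_one' m_assoc m_comm r_inv r_one)
      then have uv: "\<phi> (a \<otimes> inv b) u = v"
        using abG g wX by (simp add: u_def v_def act_act)
      have uM: "u \<in> M" using M(4)[of "inv g \<otimes> b"] g abG w(2) by (auto simp: u_def)
      have "d u v \<le> d w u + d w v"
        using uB vB triangle'[of u w v] by (auto simp: B_def commute)
      also have "\<dots> < 1 / Suc m"
        using uB vB by (auto simp: B_def field_simps)
      finally have "d u (\<phi> (a \<otimes> inv b) u) < 1 / Suc m" by (simp add: uv)
      then have "u \<in> D i" using uM ab by (auto simp: D_def i Q_def)
      then show ?thesis using uB uM V(2) by (auto simp: B_def)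
    qed
    then have "S interior_of (topspace S - D i) = {}"
      unfolding interior_of_eq_empty using openin_subset by fastforce
    then show ?thesis by (simp add: closure_of_eq_topspace)
  qed
  have "S closure_of (\<Inter>(range D)) = topspace S"
    using lc reg openD denseD by (intro Baire_category) auto
  then have "(\<Inter>(range D)) \<noteq> {}" using M(2) topS by auto
  then obtain y where y: "\<And>i. y \<in> D i" by auto
  show thesis
  proof
    have yM: "y \<in> M" using y[of "(0,0)"] by (simp add: D_def)
    then show "y \<in> L" using M(1) by blast
    fix n U assume U: "openin X U" "y \<in> U"
    then obtain r where r: "r > 0" "mball y r \<subseteq> U"
      unfolding Xd openin_mtopology by blast
    obtain m where m: "1 / Suc m < r" using r(1) nat_approx_posE by blast
    obtain q where q: "q \<in> Q n" "d y (\<phi> q y) < 1 / Suc m"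
      using y[of "(n, m)"] by (auto simp: D_def)
    have "\<phi> q y \<in> mball y r"
      using q m yM MX KX act_in[OF Qc[OF q(1)], of y] by auto
    then show "\<exists>a\<in>E n. \<exists>b\<in>E n. a \<noteq> b \<and> \<phi> (a \<otimes> inv b) y \<in> U"
      using q(1) r(2) unfolding Q_def by blast
  qed
qed

end

section \<open>The action of the positive rationals\<close>

lemma pos_rat_group_simps [simp]:
  "carrier pos_rat_group = {0<..}" "a \<otimes>\<^bsub>pos_rat_group\<^esub> b = a * b" "\<one>\<^bsub>pos_rat_group\<^esub> = 1"
  by (simp_all add: pos_rat_group_def)

lemma inv_pos_rat_group:
  assumes "q > 0"
  shows "inv\<^bsub>pos_rat_group\<^esub> q = inverse q"
proof -
  interpret comm_group pos_rat_group by (rule comm_group_pos_rat_group)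
  show ?thesis using assms by (intro inv_equality) auto
qed

lemma pos_rat_eq_divide:
  assumes "q > (0::rat)"
  obtains a b :: nat where "a > 0" "b > 0" "q = of_nat a / of_nat b"
proof -
  obtain a b where ab: "quotient_of q = (a, b)" by (cases "quotient_of q")
  then have b: "b > 0" and q: "q = of_int a / of_int b"
    by (auto simp: quotient_of_denom_pos quotient_of_div)
  then have a: "a > 0" using assms by (simp add: zero_less_divide_iff)
  have "q = of_nat (nat a) / of_nat (nat b)" using q a b by simp
  then show thesis using that[of "nat a" "nat b"] a b by simp
qed

text \<open>Take \<open>L = \<Inter>\<^sub>n nK\<close>. It is nonempty by compactness, because \<open>nK\<close> and \<open>mK\<close> both
  contain \<open>nmK\<close>. It is invariant under \<open>a / b\<close> because a point of \<open>L\<close> lies in \<open>nbK\<close> for every \<open>n\<close>,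
  and \<open>a / b\<close> maps \<open>nbK\<close> into \<open>naK \<subseteq> nK\<close>.\<close>

lemma compact_invariant_set_of_forward_invariant:
  fixes X :: "'a topology"
  assumes act: "continuous_action pos_rat_group X \<phi>" and haus: "Hausdorff_space X"
    and K: "compactin X K" "K \<noteq> {}" "\<And>n::nat. n > 0 \<Longrightarrow> \<phi> (of_nat n) ` K \<subseteq> K"
  obtains L where "compactin X L" "L \<noteq> {}" "\<And>q. q > 0 \<Longrightarrow> \<phi> q ` L \<subseteq> L"
proof -
  interpret continuous_action pos_rat_group X \<phi> by (rule act)
  have KX: "K \<subseteq> topspace X" using K(1) by (rule compactin_subset_topspace)
  have comp: "\<phi> p (\<phi> q y) = \<phi> (p * q) y" if "p > 0" "q > 0" "y \<in> topspace X" for p q y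
    using act_act[of p q y] that by simp
  define L where "L = (\<Inter>n\<in>{0<..}. \<phi> (of_nat n) ` K)"
  have cpt: "compactin X (\<phi> (of_nat n) ` K)" if "n > 0" for n
    using K(1) continuous[of "of_nat n"] that by (intro image_compactin) auto
  have clo: "closedin X (\<phi> (of_nat n) ` K)" if "n > 0" for n
    using haus cpt[OF that] by (intro compactin_imp_closedin)
  have sub: "\<phi> (of_nat (m * n)) ` K \<subseteq> \<phi> (of_nat m) ` K" if "m > 0" "n > 0" for m n
  proof
    fix y assume "y \<in> \<phi> (of_nat (m * n)) ` K"
    then obtain k where k: "k \<in> K" "y = \<phi> (of_nat (m * n)) k" by blast
    have "y = \<phi> (of_nat m) (\<phi> (of_nat n) k)"
      using comp[of "of_nat m" "of_nat n" k] that k KX by auto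
    then show "y \<in> \<phi> (of_nat m) ` K" using K(3)[OF that(2)] k(1) by blast
  qed
  have "L \<noteq> {}"
  proof -
    have ne: "K \<inter> \<Inter>\<F> \<noteq> {}"
      if "finite \<F>" "\<F> \<subseteq> (\<lambda>n. \<phi> (of_nat n) ` K) ` {0<..}" for \<F>
    proof -
      obtain N where N: "N \<subseteq> {0<..}" "finite N" "\<F> = (\<lambda>n. \<phi> (of_nat n) ` K) ` N"
        using finite_subset_image[OF \<open>finite \<F>\<close> \<open>\<F> \<subseteq> _\<close>] by blast
      define p where "p = \<Prod>N"
      have p: "p > 0" using N(1) by (auto simp: p_def intro!: prod_pos)
      have "\<phi> (of_nat p) ` K \<subseteq> \<phi> (of_nat n) ` K" if "n \<in> N" for n
      proof -
        have "n dvd p" unfolding p_def using N(2) that by (intro dvd_prodI[of N n id, simplified])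
        then obtain k where "p = n * k" by blast
        then show ?thesis using p sub[of n k] by auto
      qed
      moreover have "\<phi> (of_nat p) ` K \<subseteq> K" using K(3) p by blast
      ultimately show ?thesis using K(2) N(3) by blast
    qed
    have "K \<inter> \<Inter>((\<lambda>n. \<phi> (of_nat n) ` K) ` {0<..}) \<noteq> {}"
      using K(1) clo ne unfolding compactin_fip by (metis (no_types, lifting) greaterThan_iff imageE)
    then show ?thesis by (auto simp: L_def)
  qed
  moreover have "compactin X L"
    unfolding L_def using cpt[of 1] clo
    by (intro closed_compactin_Inter[of _ "\<phi> (of_nat 1) ` K"] image_eqI[of _ _ 1]) auto
  moreover have "\<phi> q ` L \<subseteq> L" if q: "q > 0" for q
  proof
    fix w assume "w \<in> \<phi> q ` L"
    then obtain y where y: "y \<in> L" "w = \<phi> q y" by blast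
    obtain a b :: nat where ab: "a > 0" "b > 0" "q = of_nat a / of_nat b"
      using pos_rat_eq_divide[OF q] by blast
    show "w \<in> L"
      unfolding L_def
    proof
      fix n :: nat assume n: "n \<in> {0<..}"
      then have "y \<in> \<phi> (of_nat (n * b)) ` K" using y(1) ab(2) unfolding L_def
        by (metis INT_E greaterThan_iff nat_0_less_mult_iff)
      then obtain k where k: "k \<in> K" "y = \<phi> (of_nat (n * b)) k" by blast
      have "w = \<phi> (q * of_nat (n * b)) k"
        using y(2) k KX ab(2) n q comp[of q "of_nat (n * b)" k] by (simp add: subset_iff)
      also have "q * of_nat (n * b) = of_nat n * of_nat a" using ab by simp
      also have "\<phi> \<dots> k = \<phi> (of_nat n) (\<phi> (of_nat a) k)"
        using k KX ab(1) n comp[of "of_nat n" "of_nat a" k] by (simp add: subset_iff)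
      finally have "w = \<phi> (of_nat n) (\<phi> (of_nat a) k)" .
      then show "w \<in> \<phi> (of_nat n) ` K" using K(3)[OF ab(1)] k(1) by blast
    qed
  qed
  ultimately show thesis using that by blast
qed

theorem theorem2p1:
  fixes X :: "'a topology" and \<phi> :: "rat \<Rightarrow> 'a \<Rightarrow> 'a" and x :: 'a
  assumes "locally_compact_space X" and "metrizable_space X"
    and "group_action pos_rat_group (topspace X) \<phi>"
    and "\<And>q. q \<in> carrier pos_rat_group \<Longrightarrow> homeomorphic_map X X (\<phi> q)"
    and "x \<in> topspace X"
    and "compactin X (X closure_of {\<phi> (of_nat n) x | n :: nat. n > 0})"
  shows "\<not> standard_borel (orbit_space pos_rat_group (prod_action X \<phi>)
            (borel_of (prod_topology X pos_real_top)))"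
proof -
  interpret continuous_action pos_rat_group X \<phi>
    using assms(3,4)
    by (simp add: continuous_action_def continuous_action_axioms_def homeomorphic_imp_continuous_map)
  have haus: "Hausdorff_space X" using assms(2) by (rule metrizable_imp_Hausdorff_space)
  define N where "N = {\<phi> (of_nat n) x | n :: nat. n > 0}"
  have NX: "N \<subseteq> topspace X" using act_in assms(5) by (auto simp: N_def)
  have inv: "\<phi> (of_nat n) ` (X closure_of N) \<subseteq> X closure_of N" if n: "n > 0" for n :: nat
  proof (rule act_closure_subset)
    show "\<phi> (of_nat n) ` N \<subseteq> N"
    proof
      fix w assume "w \<in> \<phi> (of_nat n) ` N"
      then obtain m :: nat where m: "m > 0" "w = \<phi> (of_nat n) (\<phi> (of_nat m) x)"
        by (auto simp: N_def)
      then have "w = \<phi> (of_nat (n * m)) x"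
        using act_act[of "of_nat n" "of_nat m" x] n assms(5) by simp
      then show "w \<in> N" using n m unfolding N_def by (auto intro!: exI[of _ "n * m"])
    qed
  qed (use n in auto)
  have "N \<noteq> {}" by (auto simp: N_def)
  then have "X closure_of N \<noteq> {}" using closure_of_subset[OF NX] by blast
  then obtain L where L: "compactin X L" "L \<noteq> {}" "\<And>q. q > 0 \<Longrightarrow> \<phi> q ` L \<subseteq> L"
    using compact_invariant_set_of_forward_invariant[OF continuous_action_axioms haus _ _ inv]
      assms(6) unfolding N_def by metis
  \<comment> \<open>Quotients of two elements of \<open>E n\<close> differ from \<open>1\<close> by less than \<open>1 / Suc n\<close>, as both are at
    least \<open>1\<close>.\<close>
  define E where "E n = {1 ..< 1 + 1 / rat_of_nat (Suc n)}" for n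
  have E: "infinite (E n)" "E n \<subseteq> carrier pos_rat_group" for n
    by (auto simp: E_def infinite_Ico)
  obtain y where y: "y \<in> L"
      "\<And>n U. openin X U \<Longrightarrow> y \<in> U \<Longrightarrow>
        \<exists>a\<in>E n. \<exists>b\<in>E n. a \<noteq> b \<and> \<phi> (a \<otimes>\<^bsub>pos_rat_group\<^esub> inv\<^bsub>pos_rat_group\<^esub> b) y \<in> U"
    using L by (elim recurrent_point_exists[OF comm_group_pos_rat_group assms(2) _ _ _ E, rotated -1])
      auto
  have yX: "y \<in> topspace X" using y(1) compactin_subset_topspace[OF L(1)] by blast
  let ?Y = "prod_topology X pos_real_top"
  let ?\<psi> = "prod_action X \<phi>"
  have cont: "continuous_map ?Y ?Y (?\<psi> q)" if q: "q > 0" for q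
  proof -
    have r: "continuous_map pos_real_top pos_real_top (\<lambda>t. of_rat q * t)"
      unfolding pos_real_top_def using q
      by (auto simp: continuous_map_in_subtopology intro!: continuous_intros)
    have "continuous_map ?Y ?Y (\<lambda>(x, t). (\<phi> q x, of_rat q * t))"
      using continuous[of q] r q by (intro continuous_map_prod_top[THEN iffD2]) auto
    then show ?thesis
      by (rule continuous_map_eq) (auto simp: prod_action_def)
  qed
  interpret Y: continuous_action pos_rat_group ?Y ?\<psi>
    using group_action_prod_action[OF assms(3)] cont
    by (simp add: continuous_action_def continuous_action_axioms_def)
  show ?thesis
  proof (rule Y.not_standard_borel_orbit_space)
    have "locally_compact_space pos_real_top"
      unfolding pos_real_top_def
      by (rule locally_compact_space_open_subset)
        (auto simp: locally_compact_space_euclidean regular_space_euclidean)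
    then show "locally_compact_space ?Y"
      using assms(1) by (simp add: locally_compact_space_prod_topology)
    have "Hausdorff_space pos_real_top"
      unfolding pos_real_top_def by (intro Hausdorff_space_subtopology) simp
    then show "Hausdorff_space ?Y"
      using haus by (simp add: Hausdorff_space_prod_topology)
    show "countable (carrier pos_rat_group)" by simp
    show "(y, 1) \<in> ?Y derived_set_of (orbit pos_rat_group ?\<psi> (y, 1))"
      unfolding in_derived_set_of
    proof (intro conjI allI impI)
      show "(y, 1) \<in> topspace ?Y" using yX by (simp add: topspace_pos_real_top)
      fix T assume T: "(y, 1) \<in> T \<and> openin ?Y T"
      then obtain U V where UV: "openin X U" "openin pos_real_top V" "y \<in> U" "1 \<in> V" "U \<times> V \<subseteq> T"
        unfolding openin_prod_topology_alt by metis
      have "open V"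
        using UV(2) open_greaterThan openin_open_eq unfolding pos_real_top_def by blast
      then obtain e where e: "e > 0" "\<And>t. dist t 1 < e \<Longrightarrow> t \<in> V"
        using UV(4) unfolding open_dist by blast
      obtain n where n: "1 / real (Suc n) < e" using e(1) nat_approx_posE by blast
      obtain a b where ab: "a \<in> E n" "b \<in> E n" "a \<noteq> b"
          "\<phi> (a \<otimes>\<^bsub>pos_rat_group\<^esub> inv\<^bsub>pos_rat_group\<^esub> b) y \<in> U"
        using y(2)[OF UV(1,3), of n] by blast
      define q where "q = a / b"
      have pos: "a > 0" "b > 0" using ab E(2) by auto
      have q: "q > 0" "q \<noteq> 1" using ab(3) pos by (auto simp: q_def)
      have qU: "\<phi> q y \<in> U"
        using ab(4) pos by (simp add: q_def inv_pos_rat_group divide_inverse)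
      have "\<bar>a - b\<bar> < 1 / rat_of_nat (Suc n)" "b \<ge> 1" using ab by (auto simp: E_def)
      then have "\<bar>q - 1\<bar> < 1 / rat_of_nat (Suc n)"
      proof -
        have "\<bar>q - 1\<bar> = \<bar>a - b\<bar> / b" using pos by (simp add: q_def diff_divide_distrib[symmetric] abs_divide field_simps)
        also have "\<dots> \<le> \<bar>a - b\<bar>" using \<open>b \<ge> 1\<close> pos by (simp add: divide_le_eq mult_le_cancel_left1)
        finally show ?thesis using \<open>\<bar>a - b\<bar> < _\<close> by simp
      qed
      then have "real_of_rat (q - 1) < real_of_rat (1 / rat_of_nat (Suc n))"
          "real_of_rat (1 - q) < real_of_rat (1 / rat_of_nat (Suc n))"
        unfolding of_rat_less by linarith+
      then have "\<bar>real_of_rat q - 1\<bar> < 1 / real (Suc n)"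
        by (simp add: of_rat_divide of_rat_diff of_rat_add abs_less_iff)
      then have "of_rat q \<in> V" using n e(2)[of "of_rat q"] by (simp add: dist_real_def)
      have val: "?\<psi> q (y, 1) = (\<phi> q y, of_rat q)"
        using yX by (simp add: prod_action_def topspace_pos_real_top)
      show "\<exists>w. w \<noteq> (y, 1) \<and> w \<in> orbit pos_rat_group ?\<psi> (y, 1) \<and> w \<in> T"
      proof (intro exI conjI)
        show "?\<psi> q (y, 1) \<noteq> (y, 1)" using q(2) by (simp add: val)
        show "?\<psi> q (y, 1) \<in> orbit pos_rat_group ?\<psi> (y, 1)" using q(1) by (auto simp: orbit_def)
        show "?\<psi> q (y, 1) \<in> T" using qU \<open>of_rat q \<in> V\<close> UV(5) by (auto simp: val)
      qed
    qed
  qed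
qed

end
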